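(* Let $(\varphi,X,Y)$ be an instance of $\Pi_2SAT$ and let $I_\varphi$ be the IAF associated with it (defined in the context). Then - $(\varphi,X,Y)\in\Pi_2SAT$ iff $(\varphi,\varphi)\in SRE^+(I_\varphi+\{(\varphi,w)\},\emptyset,\mathtt{pr}\text{-}true)$; and - $(\varphi,X,Y)\in\Pi_2SAT$ iff $(\varphi,w)\in SRE^-(I_\varphi-\{(\varphi,\varphi)\},\emptyset,\mathtt{pr}\text{-}true)$.
   Context: An instance of $\Pi_2SAT$ is a triple $(\varphi,X,Y)$ with $X,Y$ disjoint sets of boolean variables and $\varphi=\bigwedge_i c_i$ a formula in conjunctive normal form, each clause $c_i$ a disjunction of literals over $X\cup Y$. $(\varphi,X,Y)\in\Pi_2SAT$ means: for every assignment $\tau_X$ of $X$ there exists an assignment $\tau_Y$ of $Y$ such that $\varphi[\tau_X,\tau_Y]=true$. An argumentation framework (AF) is a pair $F=\langle \mathcal{A}_F,\mathcal{R}_F\rangle$ with $\mathcal{R}_F\subseteq\mathcal{A}_F\times\mathcal{A}_F$; $a$ attacks $b$ if $(a,b)\in\mathcal{R}_F$. A set $S\subseteq\mathcal{A}_F$ is conflict-free if no element of $S$ attacks an element of $S$; $S$ defends $a$ if every attacker of $a$ is attacked by some element of $S$; $S\in\mathtt{ad}(F)$ (admissible) iff $S$ is conflict-free and defends each of its elements; $S\in\mathtt{pr}(F)$ (preferred) iff $S$ is $\subseteq$-maximal in $\mathtt{ad}(F)$. $S$ is $\mathtt{pr}$-$true$ in $F$ iff $S\in\mathtt{pr}(F)$.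 An incomplete argumentation framework (IAF) is $I=\langle\mathcal{A},\mathcal{A}^?,\mathcal{R},\mathcal{R}^?\rangle$ with $\mathcal{A},\mathcal{A}^?$ disjoint sets of (certain, uncertain) arguments and $\mathcal{R},\mathcal{R}^?$ disjoint subsets of $(\mathcal{A}\cup\mathcal{A}^?)\times(\mathcal{A}\cup\mathcal{A}^?)$ (certain, uncertain attacks). A partial completion of $I$ is an IAF $I'=\langle\mathcal{A}',\mathcal{A}^{?'},\mathcal{R}',\mathcal{R}^{?'}\rangle$ with $\mathcal{A}\subseteq\mathcal{A}'\subseteq\mathcal{A}\cup\mathcal{A}^?$, $\mathcal{R}\cap((\mathcal{A}'\cup\mathcal{A}^{?'})\times(\mathcal{A}'\cup\mathcal{A}^{?'}))\subseteq\mathcal{R}'\subseteq\mathcal{R}\cup\mathcal{R}^?$, $\mathcal{A}^{?'}\subseteq\mathcal{A}^?$, $\mathcal{R}^{?'}\subseteq\mathcal{R}^?$; $part(I)$ is the set of partial completions. $cert(I)=\langle\mathcal{A},\mathcal{R}\cap(\mathcal{A}\times\mathcal{A})\rangle$. A completion of $I$ is an AF of the form $cert(I')$ with $I'\in part(I)$. $S$ is stable-$\mathtt{pr}$-$true$ w.r.t. $I$ iff $S\in\mathtt{pr}(F)$ for every completion $F$ of $I$. For $\mathcal{R}_0\subseteq\mathcal{R}^?$: $I+\mathcal{R}_0=\langle\mathcal{A},\mathcal{A}^?,\mathcal{R}\cup\mathcal{R}_0,\mathcal{R}^?\setminus\mathcal{R}_0\rangle$, $I-\mathcal{R}_0=\langle\mathcal{A},\mathcal{A}^?,\mathcal{R},\mathcal{R}^?\setminus\mathcal{R}_0\rangle$.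 Strong relevance: for an IAF $J$, a set $S$ of arguments of $J$ such that $S$ is stable-$\mathtt{pr}$-$true$ w.r.t. at least one $J_p\in part(J)$, and an uncertain attack $e$ of $J$: $e\in SRE^+(J,S,\mathtt{pr}\text{-}true)$ (resp. $e\in SRE^-(J,S,\mathtt{pr}\text{-}true)$) iff for each $J'\in part(J-\{e\})$ (resp. $J'\in part(J+\{e\})$), $S$ is not stable-$\mathtt{pr}$-$true$ w.r.t. $J'$. Construction of $I_\varphi=\langle\mathcal{A},\mathcal{A}^?,\mathcal{R},\mathcal{R}^?\rangle$ (all listed symbols are pairwise distinct arguments; $\overline{x_i},\overline{y_i}$ stand for negative literals; one argument is named $\varphi$ and one $w$): - $\mathcal{A}=\{\overline{x_i}\mid x_i\in X\}\cup\{y_i,\overline{y_i}\mid y_i\in Y\}\cup\{c_i\mid c_i\in\varphi\}\cup\{\varphi,w\}$; - $\mathcal{A}^?=\{x_i\mid x_i\in X\}$; - $\mathcal{R}=\{(x_i,\overline{x_i})\mid x_i\in X\}\cup\{(y_i,\overline{y_i}),(\overline{y_i},y_i)\mid y_i\in Y\}\cup\{(x_k,c_i)\mid x_k\in c_i\}\cup\{(\overline{x_k},c_i)\mid\neg x_k\in c_i\}\cup\{(y_k,c_i)\mid y_k\in c_i\}\cup\{(\overline{y_k},c_i)\mid\neg y_k\in c_i\}\cup\{(c_i,\varphi)\mid c_i\in\varphi\}\cup\{(c_i,c_i)\mid c_i\in\varphi\}\cup\{(w,x_i),(w,\overline{x_i})\mid x_i\in X\}\cup\{(w,y_i),(w,\overline{y_i})\mid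 y_i\in Y\}\cup\{(w,w)\}$; - $\mathcal{R}^?=\{(\varphi,\varphi),(\varphi,w)\}$. *)

theory Defs
  imports Main
begin

section \<open>Quantified satisfiability\<close>

datatype 'v literal = Pos 'v | Neg 'v

fun var :: "'v literal \<Rightarrow> 'v" where
  "var (Pos v) = v"
| "var (Neg v) = v"

fun lit_true :: "('v \<Rightarrow> bool) \<Rightarrow> 'v literal \<Rightarrow> bool" where
  "lit_true \<tau> (Pos v) \<longleftrightarrow> \<tau> v"
| "lit_true \<tau> (Neg v) \<longleftrightarrow> \<not> \<tau> v"

text \<open>A formula is the list of its clauses \<open>c\<^sub>i\<close>, a clause the list of its literals.  The empty
  conjunction (true) and the empty disjunction (false) are allowed.\<close>

type_synonym 'v cnf = "'v literal list list"

definition cnf_true :: "('v \<Rightarrow> bool) \<Rightarrow> 'v cnf \<Rightarrow> bool" where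
  "cnf_true \<tau> \<phi> \<longleftrightarrow> (\<forall>c \<in> set \<phi>. \<exists>l \<in> set c. lit_true \<tau> l)"

definition pi2sat_instance :: "'v cnf \<Rightarrow> 'v set \<Rightarrow> 'v set \<Rightarrow> bool" where
  "pi2sat_instance \<phi> X Y \<longleftrightarrow>
     finite X \<and> finite Y \<and> X \<inter> Y = {} \<and> (\<forall>c \<in> set \<phi>. \<forall>l \<in> set c. var l \<in> X \<union> Y)"

text \<open>Assignments are total functions of which only the values on \<open>X\<close>, respectively \<open>Y\<close>, matter:
  \<open>override_on \<tau>\<^sub>Y \<tau>\<^sub>X X\<close> follows \<open>\<tau>\<^sub>X\<close> on \<open>X\<close> and \<open>\<tau>\<^sub>Y\<close> elsewhere.\<close>

definition Pi2SAT :: "('v cnf \<times> 'v set \<times> 'v set) set" where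
  "Pi2SAT = {(\<phi>, X, Y). pi2sat_instance \<phi> X Y \<and>
     (\<forall>\<tau>\<^sub>X. \<exists>\<tau>\<^sub>Y. cnf_true (override_on \<tau>\<^sub>Y \<tau>\<^sub>X X) \<phi>)}"


section \<open>Argumentation frameworks\<close>

record 'a af =
  args :: "'a set"
  atts :: "('a \<times> 'a) set"

definition conflict_free :: "'a af \<Rightarrow> 'a set \<Rightarrow> bool" where
  "conflict_free F S \<longleftrightarrow> S \<subseteq> args F \<and> (\<forall>a \<in> S. \<forall>b \<in> S. (a, b) \<notin> atts F)"

definition defends :: "'a af \<Rightarrow> 'a set \<Rightarrow> 'a \<Rightarrow> bool" where
  "defends F S a \<longleftrightarrow> (\<forall>b. (b, a) \<in> atts F \<longrightarrow> (\<exists>c \<in> S. (c, b) \<in> atts F))"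

definition ad :: "'a af \<Rightarrow> 'a set set" where
  "ad F = {S. conflict_free F S \<and> (\<forall>a \<in> S. defends F S a)}"

definition pr :: "'a af \<Rightarrow> 'a set set" where
  "pr F = {S \<in> ad F. \<forall>T \<in> ad F. S \<subseteq> T \<longrightarrow> T = S}"


section \<open>Incomplete argumentation frameworks\<close>

record 'a iaf =
  cargs :: "'a set"
  uargs :: "'a set"
  catts :: "('a \<times> 'a) set"
  uatts :: "('a \<times> 'a) set"

definition all_args :: "'a iaf \<Rightarrow> 'a set" where
  "all_args I = cargs I \<union> uargs I"

definition is_iaf :: "'a iaf \<Rightarrow> bool" where
  "is_iaf I \<longleftrightarrow> cargs I \<inter> uargs I = {} \<and> catts I \<inter> uatts I = {} \<and>
     catts I \<subseteq> all_args I \<times> all_args I \<and> uatts I \<subseteq> all_args I \<times> all_args I"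

definition part :: "'a iaf \<Rightarrow> 'a iaf set" where
  "part I = {I'. is_iaf I' \<and>
     cargs I \<subseteq> cargs I' \<and> cargs I' \<subseteq> cargs I \<union> uargs I \<and>
     catts I \<inter> (all_args I' \<times> all_args I') \<subseteq> catts I' \<and> catts I' \<subseteq> catts I \<union> uatts I \<and>
     uargs I' \<subseteq> uargs I \<and> uatts I' \<subseteq> uatts I}"

definition cert :: "'a iaf \<Rightarrow> 'a af" where
  "cert I = \<lparr>args = cargs I, atts = catts I \<inter> (cargs I \<times> cargs I)\<rparr>"

definition completions :: "'a iaf \<Rightarrow> 'a af set" where
  "completions I = cert ` part I"

text \<open>A semantics \<open>\<sigma>\<close> maps a framework to its set of extensions; \<open>S\<close> is \<open>\<sigma>\<close>-true in \<open>F\<close>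
  iff \<open>S \<in> \<sigma> F\<close>.\<close>

definition stable_true :: "('a af \<Rightarrow> 'a set set) \<Rightarrow> 'a set \<Rightarrow> 'a iaf \<Rightarrow> bool" where
  "stable_true \<sigma> S I \<longleftrightarrow> (\<forall>F \<in> completions I. S \<in> \<sigma> F)"

definition add_atts :: "'a iaf \<Rightarrow> ('a \<times> 'a) set \<Rightarrow> 'a iaf" where
  "add_atts I R = I\<lparr>catts := catts I \<union> R, uatts := uatts I - R\<rparr>"

definition del_atts :: "'a iaf \<Rightarrow> ('a \<times> 'a) set \<Rightarrow> 'a iaf" where
  "del_atts I R = I\<lparr>uatts := uatts I - R\<rparr>"

text \<open>Strong relevance is only considered for pairs \<open>(J, S)\<close> satisfying the following
  presupposition.  It is kept apart from the sets \<open>SRE_plus\<close> and \<open>SRE_minus\<close>, which are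
  meaningful for such pairs only.\<close>

definition SRE_defined :: "'a iaf \<Rightarrow> 'a set \<Rightarrow> ('a af \<Rightarrow> 'a set set) \<Rightarrow> bool" where
  "SRE_defined J S \<sigma> \<longleftrightarrow> is_iaf J \<and> S \<subseteq> all_args J \<and> (\<exists>J\<^sub>p \<in> part J. stable_true \<sigma> S J\<^sub>p)"

definition SRE_plus :: "'a iaf \<Rightarrow> 'a set \<Rightarrow> ('a af \<Rightarrow> 'a set set) \<Rightarrow> ('a \<times> 'a) set" where
  "SRE_plus J S \<sigma> = {e \<in> uatts J. \<forall>J' \<in> part (del_atts J {e}). \<not> stable_true \<sigma> S J'}"

definition SRE_minus :: "'a iaf \<Rightarrow> 'a set \<Rightarrow> ('a af \<Rightarrow> 'a set set) \<Rightarrow> ('a \<times> 'a) set" where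
  "SRE_minus J S \<sigma> = {e \<in> uatts J. \<forall>J' \<in> part (add_atts J {e}). \<not> stable_true \<sigma> S J'}"


section \<open>The framework associated with a formula\<close>

text \<open>\<open>Lit (Pos v)\<close> and \<open>Lit (Neg v)\<close> are the arguments written \<open>v\<close> and \<open>v\<close> overlined.  Clause
  arguments are indexed by position, so that repeated clauses give distinct arguments.\<close>

datatype 'v argument = Lit "'v literal" | Clause nat | Phi | W

definition I_phi :: "'v cnf \<Rightarrow> 'v set \<Rightarrow> 'v set \<Rightarrow> 'v argument iaf" where
  "I_phi \<phi> X Y = \<lparr>
     cargs = {Lit (Neg x) | x. x \<in> X} \<union> {Lit (Pos y) | y. y \<in> Y} \<union> {Lit (Neg y) | y. y \<in> Y} \<union>
       {Clause i | i. i < length \<phi>} \<union> {Phi, W},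
     uargs = {Lit (Pos x) | x. x \<in> X},
     catts = {(Lit (Pos x), Lit (Neg x)) | x. x \<in> X} \<union>
       {(Lit (Pos y), Lit (Neg y)) | y. y \<in> Y} \<union> {(Lit (Neg y), Lit (Pos y)) | y. y \<in> Y} \<union>
       {(Lit l, Clause i) | l i. i < length \<phi> \<and> l \<in> set (\<phi> ! i)} \<union>
       {(Clause i, Phi) | i. i < length \<phi>} \<union> {(Clause i, Clause i) | i. i < length \<phi>} \<union>
       {(W, Lit (Pos v)) | v. v \<in> X \<union> Y} \<union> {(W, Lit (Neg v)) | v. v \<in> X \<union> Y} \<union> {(W, W)},
     uatts = {(Phi, Phi), (Phi, W)}\<rparr>"

lemma all_args_I_phi:
  "Lit l \<in> all_args (I_phi \<phi> X Y) \<longleftrightarrow> var l \<in> X \<union> Y"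
  "Clause i \<in> all_args (I_phi \<phi> X Y) \<longleftrightarrow> i < length \<phi>"
  "Phi \<in> all_args (I_phi \<phi> X Y)"
  "W \<in> all_args (I_phi \<phi> X Y)"
  by (cases l; auto simp: all_args_def I_phi_def) (simp_all add: all_args_def I_phi_def)

lemma is_iaf_I_phi:
  assumes "pi2sat_instance \<phi> X Y"
  shows "is_iaf (I_phi \<phi> X Y)"
proof -
  let ?I = "I_phi \<phi> X Y"
  have lit: "var l \<in> X \<union> Y" if "i < length \<phi>" "l \<in> set (\<phi> ! i)" for i l
    using assms that by (auto simp: pi2sat_instance_def)
  have "catts ?I \<subseteq> all_args ?I \<times> all_args ?I"
  proof (rule subrelI)
    fix a b
    assume "(a, b) \<in> catts ?I"
    then have "a \<in> all_args ?I \<and> b \<in> all_args ?I"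
      by (subst (asm) I_phi_def, simp only: iaf.simps Un_iff mem_Collect_eq prod.inject,
          elim disjE exE conjE)
        (use lit in \<open>simp_all add: all_args_I_phi\<close>)
    then show "(a, b) \<in> all_args ?I \<times> all_args ?I" by simp
  qed
  moreover have "uatts ?I \<subseteq> all_args ?I \<times> all_args ?I"
    by (subst I_phi_def) (simp add: all_args_I_phi)
  moreover have "cargs ?I \<inter> uargs ?I = {}"
    using assms by (auto simp: I_phi_def pi2sat_instance_def)
  moreover have "catts ?I \<inter> uatts ?I = {}"
    by (simp add: I_phi_def)
  ultimately show ?thesis
    by (simp add: is_iaf_def)
qed

end

theory Submission
  imports Defs
begin

text \<open>Fixing one of the two uncertain attacks as in either half of the claim leaves the same
  framework: \<open>Phi\<close> attacks \<open>W\<close> but not itself, and only the arguments \<open>Lit (Pos x)\<close> with \<open>x \<in> X\<close>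
  are uncertain.  Its completions are therefore the assignments \<open>Z \<subseteq> X\<close>.  Since \<open>W\<close> attacks every
  literal, a nonempty admissible set contains \<open>Phi\<close>, and so its literals attack every clause; they
  agree with \<open>Z\<close> on \<open>X\<close> because \<open>Lit (Neg x)\<close> cannot be defended against a present
  \<open>Lit (Pos x)\<close>.  Hence \<open>{}\<close> is preferred in the completion of \<open>Z\<close> iff \<open>Z\<close> does not extend to a
  satisfying assignment.\<close>

section \<open>Empty extension and completions of arbitrary frameworks\<close>

lemma empty_in_ad: "{} \<in> ad F"
  by (simp add: ad_def conflict_free_def)

lemma empty_in_pr_iff: "{} \<in> pr F \<longleftrightarrow> (\<forall>T \<in> ad F. T = {})"
  using empty_in_ad by (auto simp: pr_def)

lemma part_refl: "is_iaf I \<Longrightarrow> I \<in> part I"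
  by (auto simp: part_def)

text \<open>A framework seen as an incomplete one without uncertainty. As a partial completion it is
  a witness whose stability reduces to a statement about one framework.\<close>

definition iaf_of_af :: "'a af \<Rightarrow> 'a iaf" where
  "iaf_of_af F = \<lparr>cargs = args F, uargs = {}, catts = atts F, uatts = {}\<rparr>"

lemma iaf_of_af_in_part:
  assumes "cargs I \<subseteq> A" "A \<subseteq> all_args I" "catts I \<subseteq> R" "R \<subseteq> catts I \<union> uatts I"
  shows "iaf_of_af \<lparr>args = A, atts = R \<inter> (A \<times> A)\<rparr> \<in> part I"
  using assms by (auto simp: part_def is_iaf_def iaf_of_af_def all_args_def)

text \<open>With nothing uncertain, a partial completion keeps all arguments, and its certain
  attacks are squeezed between \<open>atts F\<close> and \<open>atts F\<close>. The hypothesis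
  ensures that restricting to the arguments loses no attack.\<close>

lemma completions_iaf_of_af:
  assumes "atts F \<subseteq> args F \<times> args F"
  shows "completions (iaf_of_af F) = {F}"
proof
  show "completions (iaf_of_af F) \<subseteq> {F}"
  proof
    fix G assume "G \<in> completions (iaf_of_af F)"
    then obtain I where I: "I \<in> part (iaf_of_af F)" "G = cert I"
      by (auto simp: completions_def)
    then have "cargs I = args F" "uargs I = {}"
      by (auto simp: part_def iaf_of_af_def)
    moreover from this have "atts F \<inter> (args F \<times> args F) \<subseteq> catts I" "catts I \<subseteq> atts F"
      using I(1) by (simp_all add: part_def iaf_of_af_def all_args_def)
    ultimately have "cargs I = args F" "catts I = atts F"
      using assms by blast+
    then show "G \<in> {F}"
      using assms I(2) by (simp add: cert_def inf.absorb1)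
  qed
next
  have "is_iaf (iaf_of_af F)"
    using assms by (simp add: is_iaf_def iaf_of_af_def all_args_def)
  moreover have "cert (iaf_of_af F) = F"
    using assms by (simp add: cert_def iaf_of_af_def inf.absorb1)
  ultimately show "{F} \<subseteq> completions (iaf_of_af F)"
    using part_refl by (force simp: completions_def)
qed

section \<open>The framework of a formula and its completions\<close>

lemma cargs_I_phi:
  "Lit (Pos v) \<in> cargs (I_phi \<phi> X Y) \<longleftrightarrow> v \<in> Y"
  "Lit (Neg v) \<in> cargs (I_phi \<phi> X Y) \<longleftrightarrow> v \<in> X \<union> Y"
  "Clause i \<in> cargs (I_phi \<phi> X Y) \<longleftrightarrow> i < length \<phi>"
  "Phi \<in> cargs (I_phi \<phi> X Y)"
  "W \<in> cargs (I_phi \<phi> X Y)"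
  by (auto simp: I_phi_def)

lemma uargs_I_phi: "uargs (I_phi \<phi> X Y) = Lit ` Pos ` X"
  by (auto simp: I_phi_def)

lemma uatts_I_phi: "uatts (I_phi \<phi> X Y) = {(Phi, Phi), (Phi, W)}"
  by (simp add: I_phi_def)

text \<open>Sorted by target, since defence asks for the attackers of an argument. For disjoint
  \<open>X\<close> and \<open>Y\<close>, complementary literals attack each other mutually on
  \<open>Y\<close> only; on \<open>X\<close> the positive literal has \<open>W\<close> as its sole
  attacker.\<close>

lemma catts_I_phi:
  "(a, Lit (Pos v)) \<in> catts (I_phi \<phi> X Y) \<longleftrightarrow>
     a = Lit (Neg v) \<and> v \<in> Y \<or> a = W \<and> v \<in> X \<union> Y"
  "(a, Lit (Neg v)) \<in> catts (I_phi \<phi> X Y) \<longleftrightarrow> (a = Lit (Pos v) \<or> a = W) \<and> v \<in> X \<union> Y"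
  "(a, Clause i) \<in> catts (I_phi \<phi> X Y) \<longleftrightarrow>
     i < length \<phi> \<and> (a = Clause i \<or> (\<exists>l \<in> set (\<phi> ! i). a = Lit l))"
  "(a, Phi) \<in> catts (I_phi \<phi> X Y) \<longleftrightarrow> (\<exists>i < length \<phi>. a = Clause i)"
  "(a, W) \<in> catts (I_phi \<phi> X Y) \<longleftrightarrow> a = W"
  by (auto simp: I_phi_def)

text \<open>\<open>Z\<close> selects the variables of \<open>X\<close> whose positive argument is
  present, \<open>D\<close> the uncertain attacks that are realized.\<close>

definition phi_completion ::
  "'v cnf \<Rightarrow> 'v set \<Rightarrow> 'v set \<Rightarrow> ('v argument \<times> 'v argument) set \<Rightarrow> 'v set \<Rightarrow> 'v argument af" where
  "phi_completion \<phi> X Y D Z =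
     (let A = cargs (I_phi \<phi> X Y) \<union> Lit ` Pos ` Z
      in \<lparr>args = A, atts = (catts (I_phi \<phi> X Y) \<union> D) \<inter> (A \<times> A)\<rparr>)"

lemma args_phi_completion:
  "args (phi_completion \<phi> X Y D Z) = cargs (I_phi \<phi> X Y) \<union> Lit ` Pos ` Z"
  by (simp add: phi_completion_def Let_def)

lemma in_atts_phi_completion:
  "(a, b) \<in> atts (phi_completion \<phi> X Y D Z) \<longleftrightarrow>
     ((a, b) \<in> catts (I_phi \<phi> X Y) \<or> (a, b) \<in> D) \<and>
     a \<in> args (phi_completion \<phi> X Y D Z) \<and> b \<in> args (phi_completion \<phi> X Y D Z)"
  by (auto simp: phi_completion_def Let_def)

lemma atts_phi_completion_subset:
  "atts (phi_completion \<phi> X Y D Z) \<subseteq>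
     args (phi_completion \<phi> X Y D Z) \<times> args (phi_completion \<phi> X Y D Z)"
  by (auto simp: in_atts_phi_completion)

section \<open>Admissible sets of the completions\<close>

text \<open>\<open>W\<close> and the clauses attack themselves. Every literal is attacked by
  \<open>W\<close>, and only \<open>Phi\<close> can counter that, through the attack
  \<open>(Phi, W)\<close>.\<close>

lemma ad_phi_completion:
  assumes T: "T \<in> ad (phi_completion \<phi> X Y D Z)"
    and Z: "Z \<subseteq> X"
    and D: "D \<subseteq> {(Phi, Phi), (Phi, W)}"
  shows "W \<notin> T"
    and "Clause i \<notin> T"
    and "Lit l \<in> T \<Longrightarrow> Phi \<in> T \<and> (Phi, W) \<in> D"
    and "Phi \<in> T \<Longrightarrow> (Phi, Phi) \<notin> D"
    and "Phi \<notin> T \<Longrightarrow> T = {}"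
proof -
  let ?F = "phi_completion \<phi> X Y D Z"
  have sub: "T \<subseteq> args ?F" and cf: "\<And>a b. a \<in> T \<Longrightarrow> b \<in> T \<Longrightarrow> (a, b) \<notin> atts ?F"
    and df: "\<And>a b. a \<in> T \<Longrightarrow> (b, a) \<in> atts ?F \<Longrightarrow> \<exists>c \<in> T. (c, b) \<in> atts ?F"
    using T by (auto simp: ad_def conflict_free_def defends_def)
  show W: "W \<notin> T"
    using cf[of W W] by (auto simp: in_atts_phi_completion args_phi_completion catts_I_phi cargs_I_phi)
  show clause: "Clause i \<notin> T" for i
    using cf[of "Clause i" "Clause i"] sub
    by (auto simp: in_atts_phi_completion args_phi_completion catts_I_phi cargs_I_phi)
  show lit: "Phi \<in> T \<and> (Phi, W) \<in> D" if "Lit l \<in> T" for l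
  proof -
    have "(W, Lit l) \<in> atts ?F"
      using that sub Z
      by (cases l) (auto simp: in_atts_phi_completion args_phi_completion catts_I_phi cargs_I_phi)
    then obtain c where "c \<in> T" "(c, W) \<in> atts ?F"
      using df \<open>Lit l \<in> T\<close> by blast
    then show ?thesis
      using W D by (auto simp: in_atts_phi_completion catts_I_phi)
  qed
  show "Phi \<in> T \<Longrightarrow> (Phi, Phi) \<notin> D"
    using cf[of Phi Phi] by (auto simp: in_atts_phi_completion args_phi_completion cargs_I_phi)
  show "T = {}" if "Phi \<notin> T"
  proof -
    have "a \<notin> T" for a
      using that W clause lit by (cases a) auto
    then show ?thesis by blast
  qed
qed

lemma empty_in_pr_Phi_attacks_Phi:
  assumes "Z \<subseteq> X" "D \<subseteq> {(Phi, Phi), (Phi, W)}" "(Phi, Phi) \<in> D"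
  shows "{} \<in> pr (phi_completion \<phi> X Y D Z)"
  unfolding empty_in_pr_iff using ad_phi_completion(4,5)[OF _ assms(1,2)] assms(3) by blast

text \<open>\<open>Phi\<close> needs defence against \<open>Clause i\<close>, whose attackers are
  itself, never in \<open>T\<close>, and its literals.\<close>

lemma clause_attacked_of_Phi_in_ad:
  assumes T: "T \<in> ad (phi_completion \<phi> X Y D Z)"
    and Z: "Z \<subseteq> X"
    and D: "D \<subseteq> {(Phi, Phi), (Phi, W)}"
    and "Phi \<in> T"
    and i: "i < length \<phi>"
  shows "\<exists>l \<in> set (\<phi> ! i). Lit l \<in> T"
proof -
  let ?F = "phi_completion \<phi> X Y D Z"
  have "(Clause i, Phi) \<in> atts ?F"
    using i by (simp add: in_atts_phi_completion args_phi_completion catts_I_phi cargs_I_phi)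
  then obtain c where "c \<in> T" "(c, Clause i) \<in> atts ?F"
    using T \<open>Phi \<in> T\<close> by (auto simp: ad_def defends_def)
  then show ?thesis
    using ad_phi_completion(2)[OF T Z D] D by (auto simp: in_atts_phi_completion catts_I_phi)
qed

text \<open>If \<open>Phi\<close> does not attack \<open>W\<close>, no literal can be defended, so
  no clause attacking \<open>Phi\<close> is countered. For the empty formula, \<open>{Phi}\<close>
  would be admissible.\<close>

lemma empty_in_pr_W_unattacked:
  assumes "Z \<subseteq> X" "\<phi> \<noteq> []"
  shows "{} \<in> pr (phi_completion \<phi> X Y {} Z)"
  unfolding empty_in_pr_iff
proof
  fix T assume T: "T \<in> ad (phi_completion \<phi> X Y {} Z)"
  have "Phi \<notin> T"
    using clause_attacked_of_Phi_in_ad[OF T assms(1), of 0] ad_phi_completion(3)[OF T assms(1)]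
      assms(2) by auto
  then show "T = {}"
    using ad_phi_completion(5)[OF T assms(1)] by simp
qed

lemma empty_in_pr_Phi_attacks_W_iff:
  assumes inst: "pi2sat_instance \<phi> X Y" and Z: "Z \<subseteq> X"
  shows "{} \<in> pr (phi_completion \<phi> X Y {(Phi, W)} Z) \<longleftrightarrow>
    (\<nexists>\<tau>. cnf_true (override_on \<tau> (\<lambda>x. x \<in> Z) X) \<phi>)"
    (is "{} \<in> pr ?F \<longleftrightarrow> _")
proof
  assume pr: "{} \<in> pr ?F"
  show "\<nexists>\<tau>. cnf_true (override_on \<tau> (\<lambda>x. x \<in> Z) X) \<phi>"
  proof
    assume "\<exists>\<tau>. cnf_true (override_on \<tau> (\<lambda>x. x \<in> Z) X) \<phi>"
    then obtain \<tau> where sat: "cnf_true (override_on \<tau> (\<lambda>x. x \<in> Z) X) \<phi>" ..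
    define \<rho> where "\<rho> = override_on \<tau> (\<lambda>x. x \<in> Z) X"
    have \<rho>: "\<rho> v \<longleftrightarrow> v \<in> Z" if "v \<in> X" for v
      using that by (simp add: \<rho>_def override_on_def)
    \<comment> \<open>The admissible set encoding a satisfying assignment: \<open>Phi\<close> and
      all literals true under \<open>\<rho>\<close>.\<close>
    define T where "T = insert Phi ({Lit (Pos v) | v. v \<in> X \<union> Y \<and> \<rho> v} \<union>
      {Lit (Neg v) | v. v \<in> X \<union> Y \<and> \<not> \<rho> v})"
    have Lit_T: "Lit l \<in> T \<longleftrightarrow> var l \<in> X \<union> Y \<and> lit_true \<rho> l" for l
      by (cases l) (auto simp: T_def)
    have sub: "T \<subseteq> args ?F"
    proof
      fix a assume "a \<in> T"
      \<comment> \<open>A true positive literal over \<open>X\<close> has its variable in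
        \<open>Z\<close>, so its argument is present.\<close>
      then show "a \<in> args ?F"
        using \<rho> by (auto simp: T_def args_phi_completion cargs_I_phi)
    qed
    have clause: "\<exists>c \<in> T. (c, Clause i) \<in> atts ?F" if i: "i < length \<phi>" for i
    proof -
      from sat i obtain l where l: "l \<in> set (\<phi> ! i)" "lit_true \<rho> l"
        unfolding cnf_true_def \<rho>_def using nth_mem by blast
      moreover have "var l \<in> X \<union> Y"
        using inst i l(1) by (auto simp: pi2sat_instance_def)
      ultimately have "Lit l \<in> T"
        by (simp add: Lit_T)
      moreover have "(Lit l, Clause i) \<in> atts ?F"
        using subsetD[OF sub \<open>Lit l \<in> T\<close>] l(1) i
        by (simp add: in_atts_phi_completion catts_I_phi args_phi_completion cargs_I_phi)
      ultimately show ?thesis by blast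
    qed
    have W: "\<exists>c \<in> T. (c, W) \<in> atts ?F"
      by (auto simp: T_def in_atts_phi_completion args_phi_completion cargs_I_phi)
    have "(a, b) \<notin> atts ?F" if "a \<in> T" "b \<in> T" for a b
      using that by (auto simp: T_def in_atts_phi_completion catts_I_phi)
    then have "conflict_free ?F T"
      using sub by (simp add: conflict_free_def)
    moreover have "defends ?F T a" if a: "a \<in> T" for a
      unfolding defends_def
    proof (intro allI impI)
      fix b assume b: "(b, a) \<in> atts ?F"
      then have bF: "b \<in> args ?F" and aF: "a \<in> args ?F"
        by (simp_all add: in_atts_phi_completion)
      from a consider "a = Phi" | v where "a = Lit (Pos v)" "\<rho> v" | v where "a = Lit (Neg v)" "\<not> \<rho> v"
        by (auto simp: T_def)
      then show "\<exists>c \<in> T. (c, b) \<in> atts ?F"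
      proof cases
        case 1
        then show ?thesis
          using b clause by (auto simp: in_atts_phi_completion[of _ Phi] catts_I_phi)
      next
        case 2
        \<comment> \<open>An attacking literal is the negative one over \<open>Y\<close>, where the
          attack is mutual, so \<open>a\<close> strikes back itself.\<close>
        then have "b = W \<or> (a, b) \<in> atts ?F"
          using b by (auto simp: in_atts_phi_completion catts_I_phi)
        then show ?thesis using W a by blast
      next
        case 3
        then consider "b = W" | "b = Lit (Pos v)" "v \<in> X \<union> Y"
          using b by (auto simp: in_atts_phi_completion catts_I_phi)
        then show ?thesis
        proof cases
          case 2
          \<comment> \<open>The attacker is present, so \<open>v\<close> lies in \<open>Y\<close> or
            in \<open>Z\<close>; the latter contradicts that \<open>\<rho> v\<close> is false. On
            \<open>Y\<close> the attack is again mutual.\<close>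
          then have "v \<in> Y"
            using 3 bF \<rho> Z by (auto simp: args_phi_completion cargs_I_phi)
          then have "(a, b) \<in> atts ?F"
            using 2 3 aF bF by (simp add: in_atts_phi_completion catts_I_phi)
          then show ?thesis using a by blast
        qed (use W in blast)
      qed
    qed
    ultimately have "T \<in> ad ?F"
      by (simp add: ad_def)
    then show False
      using pr by (auto simp: empty_in_pr_iff T_def)
  qed
next
  assume unsat: "\<nexists>\<tau>. cnf_true (override_on \<tau> (\<lambda>x. x \<in> Z) X) \<phi>"
  show "{} \<in> pr ?F"
    unfolding empty_in_pr_iff
  proof
    fix T assume T: "T \<in> ad ?F"
    have D: "{(Phi, W)} \<subseteq> {(Phi, Phi), (Phi, W)}" by simp
    have sub: "T \<subseteq> args ?F" and cf: "\<And>a b. a \<in> T \<Longrightarrow> b \<in> T \<Longrightarrow> (a, b) \<notin> atts ?F"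
      and df: "\<And>a b. a \<in> T \<Longrightarrow> (b, a) \<in> atts ?F \<Longrightarrow> \<exists>c \<in> T. (c, b) \<in> atts ?F"
      using T by (auto simp: ad_def conflict_free_def defends_def)
    have disj: "X \<inter> Y = {}"
      using inst by (simp add: pi2sat_instance_def)
    \<comment> \<open>Variables without a literal in \<open>T\<close> default to false, which is
      harmless: each clause is satisfied by a literal in \<open>T\<close>. Values on
      \<open>X\<close> are overridden by \<open>Z\<close>.\<close>
    define \<tau> where "\<tau> v \<longleftrightarrow> Lit (Pos v) \<in> T" for v
    have true: "lit_true (override_on \<tau> (\<lambda>x. x \<in> Z) X) l" if l: "Lit l \<in> T" for l
    proof (cases l)
      case (Pos v)
      then show ?thesis
        using subsetD[OF sub l] l disj
        by (auto simp: override_on_def \<tau>_def args_phi_completion cargs_I_phi)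
    next
      case (Neg v)
      show ?thesis
      proof (cases "v \<in> X")
        case True
        have "v \<notin> Z"
        proof
          assume "v \<in> Z"
          then have "(Lit (Pos v), Lit (Neg v)) \<in> atts ?F"
            using True by (simp add: in_atts_phi_completion args_phi_completion catts_I_phi cargs_I_phi)
          \<comment> \<open>Only \<open>W\<close> attacks \<open>Lit (Pos v)\<close> for
            \<open>v\<close> in \<open>X\<close>, and \<open>W\<close> is never in
            \<open>T\<close>.\<close>
          then obtain c where "c \<in> T" "(c, Lit (Pos v)) \<in> atts ?F"
            using df l Neg by blast
          then show False
            using ad_phi_completion(1)[OF T Z D] True disj
            by (auto simp: in_atts_phi_completion catts_I_phi)
        qed
        then show ?thesis using True Neg by simp
      next
        case False
        \<comment> \<open>Here \<open>v\<close> is in \<open>Y\<close>, so both literals are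
          arguments and would conflict.\<close>
        have "Lit (Pos v) \<notin> T"
          using cf[of "Lit (Pos v)" "Lit (Neg v)"] l Neg subsetD[OF sub l] False Z
          by (auto simp: in_atts_phi_completion args_phi_completion catts_I_phi cargs_I_phi)
        then show ?thesis using False Neg by (simp add: \<tau>_def)
      qed
    qed
    have "Phi \<notin> T"
    proof
      assume "Phi \<in> T"
      then have "cnf_true (override_on \<tau> (\<lambda>x. x \<in> Z) X) \<phi>"
        unfolding cnf_true_def all_set_conv_all_nth
        using clause_attacked_of_Phi_in_ad[OF T Z D] true by blast
      then show False using unsat by blast
    qed
    then show "T = {}"
      using ad_phi_completion(5)[OF T Z D] by simp
  qed
qed

section \<open>From assignments to strong relevance\<close>

lemma Pi2SAT_iff_subsets:
  assumes "pi2sat_instance \<phi> X Y"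
  shows "(\<phi>, X, Y) \<in> Pi2SAT \<longleftrightarrow>
    (\<forall>Z \<subseteq> X. \<exists>\<tau>. cnf_true (override_on \<tau> (\<lambda>x. x \<in> Z) X) \<phi>)"
proof
  assume "(\<phi>, X, Y) \<in> Pi2SAT"
  then show "\<forall>Z \<subseteq> X. \<exists>\<tau>. cnf_true (override_on \<tau> (\<lambda>x. x \<in> Z) X) \<phi>"
    by (simp add: Pi2SAT_def)
next
  assume ext: "\<forall>Z \<subseteq> X. \<exists>\<tau>. cnf_true (override_on \<tau> (\<lambda>x. x \<in> Z) X) \<phi>"
  have "\<exists>\<tau>. cnf_true (override_on \<tau> \<tau>\<^sub>X X) \<phi>" for \<tau>\<^sub>X
  proof -
    have "{x \<in> X. \<tau>\<^sub>X x} \<subseteq> X" by blast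
    then obtain \<tau> where "cnf_true (override_on \<tau> (\<lambda>x. x \<in> {x \<in> X. \<tau>\<^sub>X x}) X) \<phi>"
      using ext by blast
    moreover have "override_on \<tau> (\<lambda>x. x \<in> {x \<in> X. \<tau>\<^sub>X x}) X = override_on \<tau> \<tau>\<^sub>X X"
      by (auto simp: override_on_def)
    ultimately show ?thesis by auto
  qed
  then show "(\<phi>, X, Y) \<in> Pi2SAT"
    using assms by (simp add: Pi2SAT_def)
qed

text \<open>The bounds on \<open>D\<close> let it realize any choice of the attacks that
  \<open>J\<close> leaves undecided.\<close>

lemma phi_completion_in_part:
  assumes "Z \<subseteq> X"
    and "cargs J = cargs (I_phi \<phi> X Y)" "uargs J = uargs (I_phi \<phi> X Y)"
    and "catts J \<subseteq> catts (I_phi \<phi> X Y) \<union> D"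
    and "catts (I_phi \<phi> X Y) \<union> D \<subseteq> catts J \<union> uatts J"
  shows "iaf_of_af (phi_completion \<phi> X Y D Z) \<in> part J"
  unfolding phi_completion_def Let_def
  by (rule iaf_of_af_in_part) (use assms in \<open>auto simp: all_args_def uargs_I_phi\<close>)

lemma stable_true_phi_completion:
  "stable_true \<sigma> S (iaf_of_af (phi_completion \<phi> X Y D Z)) \<longleftrightarrow> S \<in> \<sigma> (phi_completion \<phi> X Y D Z)"
  by (simp add: stable_true_def completions_iaf_of_af[OF atts_phi_completion_subset])

text \<open>Since no attack is uncertain, attacks between present arguments are determined, and only
  the choice of positive literals over \<open>X\<close> remains.\<close>

lemma cert_eq_phi_completion:
  assumes "J' \<in> part J"
    and J: "cargs J = cargs (I_phi \<phi> X Y)" "uargs J = uargs (I_phi \<phi> X Y)"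
      "catts J = catts (I_phi \<phi> X Y) \<union> D" "uatts J = {}"
  obtains Z where "Z \<subseteq> X" "cert J' = phi_completion \<phi> X Y D Z"
proof
  let ?Z = "{x \<in> X. Lit (Pos x) \<in> cargs J'}"
  show "?Z \<subseteq> X" by blast
  have "cargs J' = cargs (I_phi \<phi> X Y) \<union> Lit ` Pos ` ?Z"
    using assms by (auto simp: part_def uargs_I_phi)
  moreover have "catts J' \<inter> (cargs J' \<times> cargs J') = catts J \<inter> (cargs J' \<times> cargs J')"
    using assms(1) J(4) by (auto simp: part_def all_args_def)
  ultimately show "cert J' = phi_completion \<phi> X Y D ?Z"
    using J(3) by (simp add: cert_def phi_completion_def Let_def)
qed

text \<open>Stated for any \<open>J\<close> with the given fields, so that both halves of the claim
  can use it.\<close>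

lemma Pi2SAT_iff_never_stable:
  assumes inst: "pi2sat_instance \<phi> X Y"
    and J: "cargs J = cargs (I_phi \<phi> X Y)" "uargs J = uargs (I_phi \<phi> X Y)"
      "catts J = catts (I_phi \<phi> X Y) \<union> {(Phi, W)}" "uatts J = {}"
  shows "(\<phi>, X, Y) \<in> Pi2SAT \<longleftrightarrow> (\<forall>J' \<in> part J. \<not> stable_true pr {} J')"
proof -
  let ?F = "phi_completion \<phi> X Y {(Phi, W)}"
  have "(\<forall>J' \<in> part J. \<not> stable_true pr {} J') \<longleftrightarrow> (\<forall>Z \<subseteq> X. {} \<notin> pr (?F Z))"
  proof
    assume "\<forall>J' \<in> part J. \<not> stable_true pr {} J'"
    moreover have "iaf_of_af (?F Z) \<in> part J" if "Z \<subseteq> X" for Z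
      using that J by (intro phi_completion_in_part) auto
    ultimately show "\<forall>Z \<subseteq> X. {} \<notin> pr (?F Z)"
      by (simp flip: stable_true_phi_completion)
  next
    assume ns: "\<forall>Z \<subseteq> X. {} \<notin> pr (?F Z)"
    show "\<forall>J' \<in> part J. \<not> stable_true pr {} J'"
    proof
      fix J' assume J': "J' \<in> part J"
      then obtain Z where "Z \<subseteq> X" "cert J' = ?F Z"
        by (rule cert_eq_phi_completion[OF _ J])
      \<comment> \<open>One bad completion refutes stability; \<open>J'\<close>, being a partial
        completion of itself, supplies \<open>cert J'\<close>.\<close>
      moreover have "cert J' \<in> completions J'"
        using J' part_refl by (auto simp: completions_def part_def)
      ultimately show "\<not> stable_true pr {} J'"
        using ns by (auto simp: stable_true_def)
    qed
  qed
  then show ?thesis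
    using empty_in_pr_Phi_attacks_W_iff[OF inst] Pi2SAT_iff_subsets[OF inst] by auto
qed

lemma is_iaf_add_atts: "is_iaf I \<Longrightarrow> R \<subseteq> uatts I \<Longrightarrow> is_iaf (add_atts I R)"
  by (auto simp: is_iaf_def add_atts_def all_args_def)

lemma is_iaf_del_atts: "is_iaf I \<Longrightarrow> is_iaf (del_atts I R)"
  by (auto simp: is_iaf_def del_atts_def all_args_def)

text \<open>The last two conjuncts record the presupposition of strong relevance. In the second half
  it fails for the empty formula: \<open>Phi\<close> is then unattacked in every completion, so
  \<open>{}\<close> is never preferred.\<close>

theorem proposition8:
  fixes \<phi> :: "'v cnf" and X Y :: "'v set"
  assumes "pi2sat_instance \<phi> X Y"
  shows
    "((\<phi>, X, Y) \<in> Pi2SAT \<longleftrightarrow>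
        (Phi, Phi) \<in> SRE_plus (add_atts (I_phi \<phi> X Y) {(Phi, W)}) {} pr) \<and>
     ((\<phi>, X, Y) \<in> Pi2SAT \<longleftrightarrow>
        (Phi, W) \<in> SRE_minus (del_atts (I_phi \<phi> X Y) {(Phi, Phi)}) {} pr) \<and>
     SRE_defined (add_atts (I_phi \<phi> X Y) {(Phi, W)}) {} pr \<and>
     (\<phi> \<noteq> [] \<longrightarrow> SRE_defined (del_atts (I_phi \<phi> X Y) {(Phi, Phi)}) {} pr)"
proof (intro conjI impI)
  let ?I = "I_phi \<phi> X Y"
  let ?P = "add_atts ?I {(Phi, W)}" and ?M = "del_atts ?I {(Phi, Phi)}"
  show "(\<phi>, X, Y) \<in> Pi2SAT \<longleftrightarrow> (Phi, Phi) \<in> SRE_plus ?P {} pr"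
    unfolding SRE_plus_def
    by (subst Pi2SAT_iff_never_stable[OF assms, of "del_atts ?P {(Phi, Phi)}"])
      (auto simp: add_atts_def del_atts_def uatts_I_phi)
  show "(\<phi>, X, Y) \<in> Pi2SAT \<longleftrightarrow> (Phi, W) \<in> SRE_minus ?M {} pr"
    unfolding SRE_minus_def
    by (subst Pi2SAT_iff_never_stable[OF assms, of "add_atts ?M {(Phi, W)}"])
      (auto simp: add_atts_def del_atts_def uatts_I_phi)
  show "SRE_defined ?P {} pr"
  proof -
    \<comment> \<open>Realizing the self-attack of \<open>Phi\<close> leaves only the empty set
      admissible.\<close>
    let ?F = "phi_completion \<phi> X Y {(Phi, Phi), (Phi, W)} {}"
    have "iaf_of_af ?F \<in> part ?P"
      by (rule phi_completion_in_part) (auto simp: add_atts_def uatts_I_phi)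
    moreover have "stable_true pr {} (iaf_of_af ?F)"
      by (simp add: stable_true_phi_completion empty_in_pr_Phi_attacks_Phi)
    ultimately show ?thesis
      using is_iaf_add_atts[OF is_iaf_I_phi[OF assms]] by (auto simp: SRE_defined_def uatts_I_phi)
  qed
  show "SRE_defined ?M {} pr" if "\<phi> \<noteq> []"
  proof -
    \<comment> \<open>Dropping \<open>(Phi, W)\<close> makes every literal indefensible.\<close>
    let ?F = "phi_completion \<phi> X Y {} {}"
    have "iaf_of_af ?F \<in> part ?M"
      by (rule phi_completion_in_part) (auto simp: del_atts_def)
    moreover have "stable_true pr {} (iaf_of_af ?F)"
      using that by (simp add: stable_true_phi_completion empty_in_pr_W_unattacked)
    ultimately show ?thesis
      using is_iaf_del_atts[OF is_iaf_I_phi[OF assms]] by (auto simp: SRE_defined_def)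
  qed
qed

end
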